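(* Let $\Bbbk$ be a field, let $X$ be a (finite, bounded) polyhedral complex which is acyclic over $\Bbbk$, and let $B$ be a finite index set. There is a one-to-one correspondence between the following. (a) Families $\{C_i\}_{i\in B}$ of induced subcomplexes of $X$ such that for each $B'\subseteq B$ the intersection $\bigcap_{i\in B'} C_i$ is either empty or acyclic over $\Bbbk$. (b) Monomial labellings of $X$ with square free monomials in $S=\Bbbk[x_i]_{i\in B}$ such that the cellular complex $\mathcal{F}(X;\Bbbk)$ gives a cellular resolution of the ideal generated by these monomials. The correspondence is given as follows: given a monomial labelling $v\mapsto \mathbf{x}^{\mathbf{a}_v}$, define $C_i = X_{\le \mathbf{1}-e_i}$ for $i\in B$; and given a family $\{C_i\}_{i\in B}$, define the label of each vertex $v$ to be $\mathbf{x}^{\mathbf{a}_v}=\prod_{i\in B:\, v\notin C_i} x_i$.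
   Context: A (bounded) polyhedral complex $X$ is a finite family of convex polytopes such that all faces of a polytope in $X$ are in $X$, and the intersection of any two polytopes in $X$ is a face of both. Its vertices are its $0$-dimensional faces. The subcomplex induced by a set $V'$ of vertices consists of all faces of $X$ whose vertices all lie in $V'$; an induced subcomplex is one of this form (possibly empty). The intersection over the empty index set is $X$. "Acyclic over $\Bbbk$" means nonempty with vanishing reduced homology over $\Bbbk$. A monomial labelling of $X$ assigns to each vertex $v$ a monomial $\mathbf{x}^{\mathbf{a}_v}$ in $S=\Bbbk[x_i]_{i\in B}$; each face $F$ is then labelled by $\mathbf{x}^{\mathbf{a}_F}=\mathrm{lcm}_{v\in F}\{\mathbf{x}^{\mathbf{a}_v}\}$ (the empty face, of dimension $-1$, has label $1$). The cellular complex $\mathcal{F}(X;\Bbbk)$ is the complex of free $S$-modules with terms $\mathcal{F}_i(X;\Bbbk)=\bigoplus_{\dim F=i} S F$, $i\ge -1$, with basis element $F$ in multidegree $\mathbf{a}_F$, and differential $$\partial_i(F)=\sum_{G \text{ facet of } F}\mathrm{sign}(G,F)\,\frac{\mathbf{x}^{\mathbf{a}_F}}{\mathbf{x}^{\mathbf{a}_G}}\,G,$$ where $\mathrm{sign}(G,F)\in\{1,-1\}$ are the incidence signs of the reduced chain complex of $X$. The cokernel of $\partial_0$ is $S/I$, with $I$ the ideal generated by the vertex labels; $\mathcal{F}(X;\Bbbk)$ gives a cellular resolution of $I$ if it is a free resolution of $S/I$ (not necessarily minimal). For $\mathbf{b}\in\mathbb{N}^B$, $X_{\le\mathbf{b}}$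 is the subcomplex of $X$ induced on the vertices $v$ such that $\mathbf{x}^{\mathbf{a}_v}$ divides $\mathbf{x}^{\mathbf{b}}$. Here $e_i$ is the $i$-th unit coordinate vector of $\mathbb{N}^B$ and $\mathbf{1}=\sum_{i\in B}e_i$. *)

theory Defs
  imports
    "HOL-Analysis.Analysis"
    "HOL-Algebra.Ideal"
    "HOL-Library.FuncSet"
    "HOL-Library.Poly_Mapping"
begin

section \<open>Polyhedral complexes\<close>

text \<open>
  Faces are sets of points and include the empty set, with \<open>aff_dim {} = -1\<close>: every
  polyhedral complex other than the void family contains the empty face, and so does every
  induced subcomplex.
\<close>

definition polyhedral_complex :: "'a::euclidean_space set set \<Rightarrow> bool" where
  "polyhedral_complex X \<longleftrightarrow>
     finite X \<and>
     (\<forall>F\<in>X. polytope F) \<and>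
     (\<forall>F\<in>X. \<forall>G. G face_of F \<longrightarrow> G \<in> X) \<and>
     (\<forall>F\<in>X. \<forall>G\<in>X. (F \<inter> G) face_of F \<and> (F \<inter> G) face_of G)"

definition vertices :: "'a::euclidean_space set set \<Rightarrow> 'a set" where
  "vertices X = {v. {v} \<in> X}"

definition induced_subcomplex ::
  "'a::euclidean_space set set \<Rightarrow> 'a set \<Rightarrow> 'a set set" where
  "induced_subcomplex X V = {F \<in> X. {v. v extreme_point_of F} \<subseteq> V}"

definition induced_subcomplexes :: "'a::euclidean_space set set \<Rightarrow> 'a set set set" where
  "induced_subcomplexes X = induced_subcomplex X ` Pow (vertices X)"

text \<open>A complex is empty if its only possible face is the empty one.\<close>

definition empty_complex :: "'a set set \<Rightarrow> bool" where
  "empty_complex K \<longleftrightarrow> (\<forall>F\<in>K. F = {})"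

text \<open>
  Unlike the library's \<open>facet_of\<close>, this relation also counts the empty face as a
  facet of each vertex, as is needed for augmented complexes.
\<close>

definition cell_facet :: "'a::euclidean_space set \<Rightarrow> 'a set \<Rightarrow> bool" where
  "cell_facet G F \<longleftrightarrow> G face_of F \<and> aff_dim G = aff_dim F - 1"

text \<open>
  Systems of incidence signs, in the usual axiomatic form for regular cell complexes
  (\<open>\<epsilon> G F\<close> is sign(G,F)): units on facets, equal to 1 in the augmentation, and such that the
  boundary operator squares to zero.  Every choice of orientations of the faces gives one,
  and any two differ only by reorienting faces.
\<close>

definition incidence_signs ::
  "'a::euclidean_space set set \<Rightarrow> ('a set \<Rightarrow> 'a set \<Rightarrow> int) \<Rightarrow> bool" where
  "incidence_signs X \<epsilon> \<longleftrightarrow>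
     (\<forall>F\<in>X. \<forall>G. cell_facet G F \<longrightarrow> \<epsilon> G F \<in> {1, -1}) \<and>
     (\<forall>v\<in>vertices X. \<epsilon> {} {v} = 1) \<and>
     (\<forall>F\<in>X. \<forall>H. H face_of F \<and> aff_dim H = aff_dim F - 2 \<longrightarrow>
        (\<Sum>G | cell_facet H G \<and> cell_facet G F. \<epsilon> H G * \<epsilon> G F) = 0)"


section \<open>Reduced homology over a field\<close>

definition reduced_chains ::
  "'a::euclidean_space set set \<Rightarrow> int \<Rightarrow> ('a set \<Rightarrow>\<^sub>0 'k::field) set" where
  "reduced_chains K n = {c. Poly_Mapping.keys c \<subseteq> {F \<in> K. aff_dim F = n}}"

definition reduced_boundary ::
  "('a::euclidean_space set \<Rightarrow> 'a set \<Rightarrow> int) \<Rightarrow> ('a set \<Rightarrow>\<^sub>0 'k::field) \<Rightarrow> ('a set \<Rightarrow>\<^sub>0 'k)" where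
  "reduced_boundary \<epsilon> c =
     (\<Sum>F\<in>Poly_Mapping.keys c. \<Sum>G | cell_facet G F.
        Poly_Mapping.single G (of_int (\<epsilon> G F) * Poly_Mapping.lookup c F))"

definition reduced_cycles ::
  "('a::euclidean_space set \<Rightarrow> 'a set \<Rightarrow> int) \<Rightarrow> 'a set set \<Rightarrow> int \<Rightarrow> ('a set \<Rightarrow>\<^sub>0 'k::field) set" where
  "reduced_cycles \<epsilon> K n = {c \<in> reduced_chains K n. reduced_boundary \<epsilon> c = 0}"

definition reduced_boundaries ::
  "('a::euclidean_space set \<Rightarrow> 'a set \<Rightarrow> int) \<Rightarrow> 'a set set \<Rightarrow> int \<Rightarrow> ('a set \<Rightarrow>\<^sub>0 'k::field) set" where
  "reduced_boundaries \<epsilon> K n = reduced_boundary \<epsilon> ` reduced_chains K (n + 1)"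

definition reduced_homology ::
  "('a::euclidean_space set \<Rightarrow> 'a set \<Rightarrow> int) \<Rightarrow> 'a set set \<Rightarrow> int \<Rightarrow> ('a set \<Rightarrow>\<^sub>0 'k::field) set set" where
  "reduced_homology \<epsilon> K n =
     reduced_cycles \<epsilon> K n //
       {(c, d). c \<in> reduced_cycles \<epsilon> K n \<and> d \<in> reduced_cycles \<epsilon> K n \<and>
                c - d \<in> reduced_boundaries \<epsilon> K n}"

text \<open>The zero class of the quotient is the set of boundaries.\<close>

definition acyclic_over ::
  "'k::field itself \<Rightarrow> ('a::euclidean_space set \<Rightarrow> 'a set \<Rightarrow> int) \<Rightarrow> 'a set set \<Rightarrow> bool" where
  "acyclic_over _ \<epsilon> K \<longleftrightarrow>
     \<not> empty_complex K \<and>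
     (\<forall>n\<ge>-1. (reduced_homology \<epsilon> K n :: ('a set \<Rightarrow>\<^sub>0 'k) set set) = {reduced_boundaries \<epsilon> K n})"


section \<open>Monomial labellings and cellular complexes\<close>

text \<open>
  A monomial is given by its exponent vector in \<open>'i \<Rightarrow>\<^sub>0 nat\<close>; the polynomial ring in the
  variables indexed by \<open>B\<close> consists of the polynomials over \<open>'i\<close> whose monomials only
  involve \<open>B\<close>.
\<close>

type_synonym ('i, 'k) mpolynomial = "('i \<Rightarrow>\<^sub>0 nat) \<Rightarrow>\<^sub>0 'k"

definition monomials_in :: "'i set \<Rightarrow> ('i \<Rightarrow>\<^sub>0 nat) set" where
  "monomials_in B = {m. Poly_Mapping.keys m \<subseteq> B}"

definition mpoly_ring :: "'i set \<Rightarrow> ('i, 'k::field) mpolynomial ring" where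
  "mpoly_ring B =
     \<lparr>carrier = {p. Poly_Mapping.keys p \<subseteq> monomials_in B},
      monoid.mult = (*), one = 1, zero = 0, add = (+)\<rparr>"

definition monom_poly :: "('i \<Rightarrow>\<^sub>0 nat) \<Rightarrow> ('i, 'k::field) mpolynomial" where
  "monom_poly m = Poly_Mapping.single m 1"

definition monom_dvd :: "('i \<Rightarrow>\<^sub>0 nat) \<Rightarrow> ('i \<Rightarrow>\<^sub>0 nat) \<Rightarrow> bool" where
  "monom_dvd m n \<longleftrightarrow> (\<forall>i. Poly_Mapping.lookup m i \<le> Poly_Mapping.lookup n i)"

definition squarefree_monom :: "('i \<Rightarrow>\<^sub>0 nat) \<Rightarrow> bool" where
  "squarefree_monom m \<longleftrightarrow> (\<forall>i. Poly_Mapping.lookup m i \<le> 1)"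

definition monomial_labellings ::
  "'a::euclidean_space set set \<Rightarrow> 'i set \<Rightarrow> ('a \<Rightarrow> ('i \<Rightarrow>\<^sub>0 nat)) set" where
  "monomial_labellings X B = vertices X \<rightarrow>\<^sub>E monomials_in B"

text \<open>The exponent of the lcm of the vertex labels; the empty face gets exponent 0.\<close>

definition face_label ::
  "('a::euclidean_space \<Rightarrow> ('i \<Rightarrow>\<^sub>0 nat)) \<Rightarrow> 'a set \<Rightarrow> ('i \<Rightarrow>\<^sub>0 nat)" where
  "face_label a F =
     Abs_poly_mapping
       (\<lambda>i. Max (insert 0 ((\<lambda>v. Poly_Mapping.lookup (a v) i) ` {v. v extreme_point_of F})))"

definition cellular_module ::
  "'a::euclidean_space set set \<Rightarrow> 'i set \<Rightarrow> int \<Rightarrow> ('a set \<Rightarrow>\<^sub>0 ('i, 'k::field) mpolynomial) set" where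
  "cellular_module X B n =
     {c. Poly_Mapping.keys c \<subseteq> {F \<in> X. aff_dim F = n} \<and>
         (\<forall>F. Poly_Mapping.lookup c F \<in> carrier (mpoly_ring B))}"

text \<open>
  The quotient of the monomial labels of \<open>F\<close> and of its facet \<open>G\<close> is the monomial whose
  exponent is the difference of the two exponents (truncation never occurs).
\<close>

definition cellular_differential ::
  "('a::euclidean_space set \<Rightarrow> 'a set \<Rightarrow> int) \<Rightarrow> ('a \<Rightarrow> ('i \<Rightarrow>\<^sub>0 nat)) \<Rightarrow>
   ('a set \<Rightarrow>\<^sub>0 ('i, 'k::field) mpolynomial) \<Rightarrow> ('a set \<Rightarrow>\<^sub>0 ('i, 'k) mpolynomial)" where
  "cellular_differential \<epsilon> a c =
     (\<Sum>F\<in>Poly_Mapping.keys c. \<Sum>G | cell_facet G F.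
        Poly_Mapping.single G
          (of_int (\<epsilon> G F) * monom_poly (face_label a F - face_label a G) *
           Poly_Mapping.lookup c F))"

definition label_ideal ::
  "'a::euclidean_space set set \<Rightarrow> 'i set \<Rightarrow> ('a \<Rightarrow> ('i \<Rightarrow>\<^sub>0 nat)) \<Rightarrow> ('i, 'k::field) mpolynomial set" where
  "label_ideal X B a = genideal (mpoly_ring B) ((\<lambda>v. monom_poly (a v)) ` vertices X)"

text \<open>
  The cellular complex is a free resolution of \<open>S/I\<close>: it is exact in degrees \<open>\<ge> 0\<close>, and
  under the identification of its term in degree \<open>-1\<close>, free on the empty face, with \<open>S\<close>,
  the image of the last differential is \<open>I\<close>, i.e. its cokernel is \<open>S/I\<close>.
\<close>

definition gives_cellular_resolution ::
  "'k::field itself \<Rightarrow> ('a::euclidean_space set \<Rightarrow> 'a set \<Rightarrow> int) \<Rightarrow> 'a set set \<Rightarrow> 'i set \<Rightarrow>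
   ('a \<Rightarrow> ('i \<Rightarrow>\<^sub>0 nat)) \<Rightarrow> bool" where
  "gives_cellular_resolution _ \<epsilon> X B a \<longleftrightarrow>
     (\<forall>n\<ge>0. {c \<in> cellular_module X B n.
                (cellular_differential \<epsilon> a c :: 'a set \<Rightarrow>\<^sub>0 ('i, 'k) mpolynomial) = 0} =
              cellular_differential \<epsilon> a ` cellular_module X B (n + 1)) \<and>
     (\<lambda>c. Poly_Mapping.lookup c {}) ` cellular_differential \<epsilon> a ` cellular_module X B 0 =
       (label_ideal X B a :: ('i, 'k) mpolynomial set)"

definition sublevel_complex ::
  "'a::euclidean_space set set \<Rightarrow> ('a \<Rightarrow> ('i \<Rightarrow>\<^sub>0 nat)) \<Rightarrow> ('i \<Rightarrow>\<^sub>0 nat) \<Rightarrow> 'a set set" where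
  "sublevel_complex X a b = induced_subcomplex X {v \<in> vertices X. monom_dvd (a v) b}"


section \<open>The two sides of the correspondence\<close>

text \<open>
  Families indexed by \<open>B\<close> and labellings of the vertices are extensional functions, so that
  equality of functions is equality of families and of labellings.
\<close>

definition acyclic_families ::
  "'k::field itself \<Rightarrow> ('a::euclidean_space set \<Rightarrow> 'a set \<Rightarrow> int) \<Rightarrow> 'a set set \<Rightarrow> 'i set \<Rightarrow>
   ('i \<Rightarrow> 'a set set) set" where
  "acyclic_families k \<epsilon> X B =
     {C \<in> B \<rightarrow>\<^sub>E induced_subcomplexes X.
        \<forall>B'\<subseteq>B. empty_complex (X \<inter> (\<Inter>i\<in>B'. C i)) \<or> acyclic_over k \<epsilon> (X \<inter> (\<Inter>i\<in>B'. C i))}"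

definition squarefree_resolution_labellings ::
  "'k::field itself \<Rightarrow> ('a::euclidean_space set \<Rightarrow> 'a set \<Rightarrow> int) \<Rightarrow> 'a set set \<Rightarrow> 'i set \<Rightarrow>
   ('a \<Rightarrow> ('i \<Rightarrow>\<^sub>0 nat)) set" where
  "squarefree_resolution_labellings k \<epsilon> X B =
     {a \<in> monomial_labellings X B.
        (\<forall>v\<in>vertices X. squarefree_monom (a v)) \<and> gives_cellular_resolution k \<epsilon> X B a}"

definition all_ones :: "'i set \<Rightarrow> ('i \<Rightarrow>\<^sub>0 nat)" where
  "all_ones B = (\<Sum>i\<in>B. Poly_Mapping.single i 1)"

definition family_of_labelling ::
  "'a::euclidean_space set set \<Rightarrow> 'i set \<Rightarrow> ('a \<Rightarrow> ('i \<Rightarrow>\<^sub>0 nat)) \<Rightarrow> ('i \<Rightarrow> 'a set set)" where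
  "family_of_labelling X B a =
     (\<lambda>i\<in>B. sublevel_complex X a (all_ones B - Poly_Mapping.single i 1))"

definition labelling_of_family ::
  "'a::euclidean_space set set \<Rightarrow> 'i set \<Rightarrow> ('i \<Rightarrow> 'a set set) \<Rightarrow> ('a \<Rightarrow> ('i \<Rightarrow>\<^sub>0 nat))" where
  "labelling_of_family X B C =
     (\<lambda>v\<in>vertices X. \<Sum>i | i \<in> B \<and> v \<notin> vertices (C i). Poly_Mapping.single i 1)"

end

theory Submission
  imports Defs
begin

text \<open>
  A squarefree monomial is the set of its variables. A squarefree labelling is thus a relation
  between the vertices \<open>v\<close> and the indices \<open>i\<close>, namely that \<open>x_i\<close> divides the label
  of \<open>v\<close>, and \<open>C_i\<close> is the induced subcomplex on the vertices not related to \<open>i\<close>.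
  Since induced subcomplexes are determined by their vertices, the two constructions are mutually
  inverse bijections between all squarefree labellings and all families of induced subcomplexes
  (\<open>labelling_of_family_of_labelling\<close>, \<open>family_of_labelling_of_family\<close>). What remains
  is that a labelling gives a resolution if and only if its family has empty or acyclic
  intersections.

  The bridge is the criterion of Bayer and Sturmfels (\<open>gives_cellular_resolution_iff\<close>): the
  cellular complex is a resolution if and only if for every multidegree \<open>b\<close> the subcomplex
  \<open>X_b\<close> of the faces whose label divides \<open>x^b\<close> is empty or acyclic. Indeed, the
  differential preserves multidegrees, and the strand of multidegree \<open>b\<close> has as a basis the
  elements \<open>x^(b - a_F) F\<close> with \<open>F\<close> a face of \<open>X_b\<close> and \<open>a_F\<close> its label;
  in this basis the differential is the reduced boundary of \<open>X_b\<close>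
  (\<open>degree_part_differential\<close>, \<open>differential_homogenize\<close>). A chain is the finite sum of its
  homogeneous parts, so the cellular complex is exact in a degree if and only if all \<open>X_b\<close>
  are (\<open>cellular_exact_iff\<close>). Degree -1 imposes no condition on either side: the image of the
  last differential is the ideal of the labels whatever these are
  (\<open>image_differential_eq_label_span\<close>, \<open>label_ideal_eq_span\<close>), and the empty face is a
  boundary in every nonempty complex.

  For squarefree labels \<open>X_b\<close> is the intersection of the \<open>C_i\<close> over the variables
  \<open>x_i\<close> missing from \<open>x^b\<close> (\<open>sublevel_complex_eq_Inter\<close>). As \<open>b\<close> varies, the
  set of missing variables runs through all subsets of \<open>B\<close>, so the criterion becomes the
  condition on the family.
\<close>

section \<open>Monomials and polynomials\<close>

text \<open>
  Subtraction of exponent vectors truncates at 0, so \<open>k - m\<close> is the exponent of a genuine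
  quotient only if \<open>m\<close> divides \<open>k\<close>.
\<close>

lemma eq_monom_add_iff:
  fixes m k q :: "'i \<Rightarrow>\<^sub>0 nat"
  shows "k = m + q \<longleftrightarrow> monom_dvd m k \<and> q = k - m"
proof -
  have "m + (k - m) = k" if "monom_dvd m k"
    by (rule poly_mapping_eqI) (use that in \<open>simp add: monom_dvd_def lookup_add lookup_minus\<close>)
  moreover have "monom_dvd m (m + q)"
    by (simp add: monom_dvd_def lookup_add)
  ultimately show ?thesis by auto
qed

lemma monom_dvd_trans: "monom_dvd l m \<Longrightarrow> monom_dvd m n \<Longrightarrow> monom_dvd l n"
  unfolding monom_dvd_def using order_trans by blast

lemma monom_dvd_diff_iff:
  assumes "monom_dvd l m" and "monom_dvd l n"
  shows "monom_dvd (m - l) (n - l) \<longleftrightarrow> monom_dvd m n"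
  using assms by (simp add: monom_dvd_def lookup_minus le_diff_iff)

lemma monom_diff_diff:
  assumes "monom_dvd l m" and "monom_dvd m n"
  shows "(n - l) - (m - l) = n - m" and "(m - l) + (n - m) = n - l"
  using assms
  by (auto intro!: poly_mapping_eqI simp: monom_dvd_def lookup_minus lookup_add)

lemma lookup_single_mult:
  fixes m k :: "'i \<Rightarrow>\<^sub>0 nat" and c :: "'k::field"
  shows "Poly_Mapping.lookup (Poly_Mapping.single m c * p) k =
           (if monom_dvd m k then c * Poly_Mapping.lookup p (k - m) else 0)"
proof -
  have "Poly_Mapping.lookup (Poly_Mapping.single m c * p) k =
        Sum_any (\<lambda>l. (c * Sum_any (\<lambda>q. Poly_Mapping.lookup p q when k = l + q) when m = l))"
    by (simp add: lookup_mult lookup_single when_mult)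
  also have "\<dots> = c * Sum_any (\<lambda>q. Poly_Mapping.lookup p q when k = m + q)"
    by simp
  also have "Sum_any (\<lambda>q. Poly_Mapping.lookup p q when k = m + q) =
             (if monom_dvd m k then Poly_Mapping.lookup p (k - m) else 0)"
    by (simp add: eq_monom_add_iff)
  finally show ?thesis by simp
qed

lemma of_int_mult_monom_poly:
  "of_int z * monom_poly m = Poly_Mapping.single m (of_int z :: 'k::field)"
  by (simp add: monom_poly_def mult_single flip: single_of_int)

lemma monomials_in_add:
  "m \<in> monomials_in B \<Longrightarrow> n \<in> monomials_in B \<Longrightarrow> m + n \<in> monomials_in B"
  using Poly_Mapping.keys_add[of m n] by (auto simp: monomials_in_def)

lemma monomials_in_diff: "m \<in> monomials_in B \<Longrightarrow> m - n \<in> monomials_in B"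
  by (auto simp: monomials_in_def in_keys_iff lookup_minus subset_eq)

lemma mpoly_ring_add_closed:
  "p \<in> carrier (mpoly_ring B) \<Longrightarrow> q \<in> carrier (mpoly_ring B) \<Longrightarrow> p + q \<in> carrier (mpoly_ring B)"
  using Poly_Mapping.keys_add[of p q] by (auto simp: mpoly_ring_def)

lemma mpoly_ring_uminus_closed:
  "p \<in> carrier (mpoly_ring B) \<Longrightarrow> - p \<in> carrier (mpoly_ring B)"
  by (auto simp: mpoly_ring_def in_keys_iff subset_eq)

lemma mpoly_ring_mult_closed:
  assumes "p \<in> carrier (mpoly_ring B)" and "q \<in> carrier (mpoly_ring B)"
  shows "p * q \<in> carrier (mpoly_ring B)"
proof -
  have "Poly_Mapping.keys (p * q) \<subseteq>
      {m + n | m n. m \<in> Poly_Mapping.keys p \<and> n \<in> Poly_Mapping.keys q}"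
    by (rule keys_mult)
  also have "\<dots> \<subseteq> monomials_in B"
    using assms by (auto simp: mpoly_ring_def intro!: monomials_in_add)
  finally show ?thesis by (simp add: mpoly_ring_def)
qed

lemma mpoly_ring_zero_closed: "0 \<in> carrier (mpoly_ring B)"
  by (simp add: mpoly_ring_def)

lemma mpoly_ring_sum_closed:
  "(\<And>x. x \<in> A \<Longrightarrow> f x \<in> carrier (mpoly_ring B)) \<Longrightarrow> sum f A \<in> carrier (mpoly_ring B)"
  by (induction A rule: infinite_finite_induct)
    (simp_all add: mpoly_ring_zero_closed mpoly_ring_add_closed)

lemma mpoly_ring_single_closed:
  "m \<in> monomials_in B \<Longrightarrow> Poly_Mapping.single m t \<in> carrier (mpoly_ring B)"
  by (simp add: mpoly_ring_def)

lemma cring_mpoly_ring: "cring (mpoly_ring B :: ('i, 'k::field) mpolynomial ring)"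
proof -
  let ?R = "mpoly_ring B :: ('i, 'k) mpolynomial ring"
  have ops: "x \<oplus>\<^bsub>?R\<^esub> y = x + y" "x \<otimes>\<^bsub>?R\<^esub> y = x * y" "\<zero>\<^bsub>?R\<^esub> = 0" "\<one>\<^bsub>?R\<^esub> = 1" for x y
    by (simp_all add: mpoly_ring_def)
  have one: "1 \<in> carrier ?R"
    by (simp add: mpoly_ring_def monomials_in_def)
  show ?thesis
  proof (rule cringI)
    show "abelian_group ?R"
    proof (rule abelian_groupI)
      fix p assume "p \<in> carrier ?R"
      then show "\<exists>q\<in>carrier ?R. q \<oplus>\<^bsub>?R\<^esub> p = \<zero>\<^bsub>?R\<^esub>"
        by (intro bexI[of _ "- p"]) (simp_all add: ops mpoly_ring_uminus_closed)
    qed (simp_all add: ops mpoly_ring_add_closed mpoly_ring_zero_closed algebra_simps)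
    show "comm_monoid ?R"
      by (rule comm_monoidI) (simp_all add: ops mpoly_ring_mult_closed one algebra_simps)
  qed (simp add: ops algebra_simps)
qed

section \<open>Labels of faces\<close>

lemma finite_extreme_points:
  fixes F :: "'a::euclidean_space set"
  shows "polytope F \<Longrightarrow> finite {v. v extreme_point_of F}"
  by (simp add: finite_polyhedron_extreme_points polytope_imp_polyhedron)

lemma lookup_face_label:
  fixes F :: "'a::euclidean_space set"
  assumes "polytope F"
  shows "Poly_Mapping.lookup (face_label a F) i =
    Max (insert 0 ((\<lambda>v. Poly_Mapping.lookup (a v) i) ` {v. v extreme_point_of F}))"
proof -
  let ?E = "{v. v extreme_point_of F}"
  let ?f = "\<lambda>i. Max (insert 0 ((\<lambda>v. Poly_Mapping.lookup (a v) i) ` ?E))"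
  note fin = finite_extreme_points[OF assms]
  have "?f i = 0" if "i \<notin> (\<Union>v\<in>?E. Poly_Mapping.keys (a v))" for i
    using that fin by (intro Max_eqI) (auto simp: in_keys_iff)
  then have "{i. ?f i \<noteq> 0} \<subseteq> (\<Union>v\<in>?E. Poly_Mapping.keys (a v))"
    by (intro subsetI) (unfold mem_Collect_eq, metis)
  then have "finite {i. ?f i \<noteq> 0}"
    by (rule finite_subset) (use fin in simp)
  then show ?thesis
    by (simp add: face_label_def)
qed

text \<open>
  The label of a face is the least common multiple of its vertex labels, characterised by its
  universal property.
\<close>

lemma monom_dvd_face_label_iff:
  fixes F :: "'a::euclidean_space set"
  assumes "polytope F"
  shows "monom_dvd (face_label a F) b \<longleftrightarrow> (\<forall>v. v extreme_point_of F \<longrightarrow> monom_dvd (a v) b)"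
proof -
  have "finite ((\<lambda>v. Poly_Mapping.lookup (a v) i) ` {v. v extreme_point_of F})" for i
    using finite_extreme_points[OF assms] by simp
  then have "Poly_Mapping.lookup (face_label a F) i \<le> n \<longleftrightarrow>
      (\<forall>v. v extreme_point_of F \<longrightarrow> Poly_Mapping.lookup (a v) i \<le> n)" for i n
    unfolding lookup_face_label[OF assms] by (subst Max_le_iff) auto
  then show ?thesis
    unfolding monom_dvd_def by metis
qed

lemma face_label_empty [simp]: "face_label a {} = 0"
  by (rule poly_mapping_eqI) (simp add: lookup_face_label polytope_sing polytope_empty)

lemma face_label_singleton [simp]: "face_label a {v} = a v"
  by (rule poly_mapping_eqI) (simp add: lookup_face_label polytope_sing polytope_empty)

section \<open>Reduced homology of polyhedral complexes\<close>

text \<open>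
  The boundary maps of \<open>X\<close> and of the cellular complex sum over the support of a chain. Read
  off coefficientwise and with the sum extended to all of \<open>X\<close>, they become visibly linear.
\<close>

lemma lookup_sum_boundary:
  fixes f :: "'a::euclidean_space set \<Rightarrow> 'a set \<Rightarrow> 'b::comm_monoid_add"
  assumes "finite X" and "\<And>F. F \<in> X \<Longrightarrow> finite {G. cell_facet G F}"
    and "S \<subseteq> X" and "\<And>F G. F \<in> X - S \<Longrightarrow> f G F = 0"
  shows "Poly_Mapping.lookup (\<Sum>F\<in>S. \<Sum>G | cell_facet G F. Poly_Mapping.single G (f G F)) G =
           (\<Sum>F | F \<in> X \<and> cell_facet G F. f G F)"
proof -
  have "Poly_Mapping.lookup (\<Sum>F\<in>S. \<Sum>G | cell_facet G F. Poly_Mapping.single G (f G F)) G =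
        (\<Sum>F\<in>S. \<Sum>H | cell_facet H F. if H = G then f G F else 0)"
    unfolding lookup_sum lookup_single when_def by (intro sum.cong) auto
  also have "\<dots> = (\<Sum>F\<in>S. if cell_facet G F then f G F else 0)"
  proof (intro sum.cong refl)
    fix F assume "F \<in> S"
    then have "finite {G. cell_facet G F}"
      using assms by blast
    from sum.delta[OF this, of G "\<lambda>_. f G F"]
    show "(\<Sum>H | cell_facet H F. if H = G then f G F else 0) = (if cell_facet G F then f G F else 0)"
      by simp
  qed
  also have "\<dots> = (\<Sum>F\<in>X. if cell_facet G F then f G F else 0)"
    using assms by (intro sum.mono_neutral_left) auto
  also have "\<dots> = (\<Sum>F | F \<in> X \<and> cell_facet G F. f G F)"
    using assms(1) by (rule sum.inter_filter[symmetric])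
  finally show ?thesis .
qed

lemma extreme_point_is_vertex:
  "polyhedral_complex X \<Longrightarrow> F \<in> X \<Longrightarrow> v extreme_point_of F \<Longrightarrow> v \<in> vertices X"
  by (auto simp: polyhedral_complex_def vertices_def simp flip: face_of_singleton)

locale signed_complex =
  fixes X :: "'a::euclidean_space set set"
    and \<epsilon> :: "'a set \<Rightarrow> 'a set \<Rightarrow> int"
  assumes complex: "polyhedral_complex X"
    and signs: "incidence_signs X \<epsilon>"
begin

lemma finite_X: "finite X"
  and polytope_cell: "F \<in> X \<Longrightarrow> polytope F"
  and face_in_X: "F \<in> X \<Longrightarrow> G face_of F \<Longrightarrow> G \<in> X"
  using complex by (auto simp: polyhedral_complex_def)

lemma facet_in_X: "F \<in> X \<Longrightarrow> cell_facet G F \<Longrightarrow> G \<in> X"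
  using face_in_X by (auto simp: cell_facet_def)

lemma finite_facets: "F \<in> X \<Longrightarrow> finite {G. cell_facet G F}"
  by (rule finite_subset[OF _ finite_X]) (auto intro: facet_in_X)

lemma finite_vertices: "finite (vertices X)"
proof -
  have "(\<lambda>v. {v}) ` vertices X \<subseteq> X"
    by (auto simp: vertices_def)
  then show ?thesis
    using finite_X finite_imageD[of "\<lambda>v. {v}" "vertices X"] finite_subset by (auto simp: inj_on_def)
qed

lemma cell_has_vertex:
  assumes "F \<in> X" and "F \<noteq> {}"
  obtains v where "v extreme_point_of F"
  using extreme_point_exists_convex[of F] polytope_cell[OF assms(1)] assms(2)
    polytope_imp_compact polytope_imp_convex by metis

lemma lookup_reduced_boundary:
  fixes c :: "'a set \<Rightarrow>\<^sub>0 'k::field"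
  assumes "Poly_Mapping.keys c \<subseteq> X"
  shows "Poly_Mapping.lookup (reduced_boundary \<epsilon> c) G =
    (\<Sum>F | F \<in> X \<and> cell_facet G F. of_int (\<epsilon> G F) * Poly_Mapping.lookup c F)"
  unfolding reduced_boundary_def
  by (rule lookup_sum_boundary[OF finite_X finite_facets assms]) (auto simp: in_keys_iff)

lemma reduced_boundary_diff:
  fixes c d :: "'a set \<Rightarrow>\<^sub>0 'k::field"
  assumes "Poly_Mapping.keys c \<subseteq> X" and "Poly_Mapping.keys d \<subseteq> X"
  shows "reduced_boundary \<epsilon> (c - d) = reduced_boundary \<epsilon> c - reduced_boundary \<epsilon> d"
proof (rule poly_mapping_eqI)
  fix G
  have "Poly_Mapping.keys (c - d) \<subseteq> X"
    using assms Poly_Mapping.keys_diff[of c d] by blast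
  then show "Poly_Mapping.lookup (reduced_boundary \<epsilon> (c - d)) G =
      Poly_Mapping.lookup (reduced_boundary \<epsilon> c - reduced_boundary \<epsilon> d) G"
    using assms
    by (simp add: lookup_reduced_boundary lookup_minus right_diff_distrib sum_subtractf)
qed

lemma reduced_boundary_zero [simp]: "reduced_boundary \<epsilon> 0 = 0"
  by (simp add: reduced_boundary_def)

lemma keys_reduced_boundary:
  fixes c :: "'a set \<Rightarrow>\<^sub>0 'k::field"
  assumes "Poly_Mapping.keys c \<subseteq> X" and "G \<in> Poly_Mapping.keys (reduced_boundary \<epsilon> c)"
  shows "\<exists>F\<in>Poly_Mapping.keys c. cell_facet G F"
proof (rule ccontr)
  assume *: "\<not> ?thesis"
  have "Poly_Mapping.lookup (reduced_boundary \<epsilon> c) G = 0"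
    unfolding lookup_reduced_boundary[OF assms(1)]
    by (rule sum.neutral) (use * in \<open>auto simp: in_keys_iff\<close>)
  then show False
    using assms(2) by (simp add: in_keys_iff)
qed

text \<open>
  The coefficient of \<open>H\<close> in the double boundary groups, over each face \<open>F\<close>, the paths
  \<open>H < G < F\<close> of codimension one steps. The incidence signs cancel on each such interval.
\<close>

lemma reduced_boundary_boundary:
  fixes c :: "'a set \<Rightarrow>\<^sub>0 'k::field"
  assumes c: "Poly_Mapping.keys c \<subseteq> X"
  shows "reduced_boundary \<epsilon> (reduced_boundary \<epsilon> c) = 0"
proof (rule poly_mapping_eqI)
  fix H
  have dc: "Poly_Mapping.keys (reduced_boundary \<epsilon> c) \<subseteq> X"
    using keys_reduced_boundary[OF c] c facet_in_X by blast
  have "Poly_Mapping.lookup (reduced_boundary \<epsilon> (reduced_boundary \<epsilon> c)) H =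
      (\<Sum>G | G \<in> X \<and> cell_facet H G. \<Sum>F | F \<in> X \<and> cell_facet G F.
        of_int (\<epsilon> H G * \<epsilon> G F) * Poly_Mapping.lookup c F)"
    by (simp add: lookup_reduced_boundary dc c sum_distrib_left mult_ac)
  also have "\<dots> = (\<Sum>F\<in>X. \<Sum>G | G \<in> {G \<in> X. cell_facet H G} \<and> cell_facet G F.
        of_int (\<epsilon> H G * \<epsilon> G F) * Poly_Mapping.lookup c F)"
    by (rule sum.swap_restrict) (use finite_X in auto)
  also have "\<dots> = (\<Sum>F\<in>X. of_int (\<Sum>G | cell_facet H G \<and> cell_facet G F. \<epsilon> H G * \<epsilon> G F) *
        Poly_Mapping.lookup c F)"
  proof (rule sum.cong[OF refl])
    fix F assume "F \<in> X"
    then have "{G. G \<in> {G \<in> X. cell_facet H G} \<and> cell_facet G F} =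
        {G. cell_facet H G \<and> cell_facet G F}"
      using facet_in_X by blast
    then show "(\<Sum>G | G \<in> {G \<in> X. cell_facet H G} \<and> cell_facet G F.
        of_int (\<epsilon> H G * \<epsilon> G F) * Poly_Mapping.lookup c F) =
      of_int (\<Sum>G | cell_facet H G \<and> cell_facet G F. \<epsilon> H G * \<epsilon> G F) * Poly_Mapping.lookup c F"
      by (simp add: sum_distrib_right)
  qed
  also have "\<dots> = 0"
  proof (rule sum.neutral, rule ballI)
    fix F assume F: "F \<in> X"
    have "(\<Sum>G | cell_facet H G \<and> cell_facet G F. \<epsilon> H G * \<epsilon> G F) = 0"
    proof (cases "\<exists>G. cell_facet H G \<and> cell_facet G F")
      case True
      then have "H face_of F \<and> aff_dim H = aff_dim F - 2"
        by (auto simp: cell_facet_def intro: face_of_trans)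
      with F show ?thesis
        using signs unfolding incidence_signs_def by blast
    next
      case False
      then have "{G. cell_facet H G \<and> cell_facet G F} = {}" by blast
      then show ?thesis by (metis sum.empty)
    qed
    then show "of_int (\<Sum>G | cell_facet H G \<and> cell_facet G F. \<epsilon> H G * \<epsilon> G F) *
        Poly_Mapping.lookup c F = 0"
      by simp
  qed
  finally show "Poly_Mapping.lookup (reduced_boundary \<epsilon> (reduced_boundary \<epsilon> c)) H =
      Poly_Mapping.lookup 0 H"
    by simp
qed

definition subcomplex :: "'a set set \<Rightarrow> bool" where
  "subcomplex K \<longleftrightarrow> K \<subseteq> X \<and> (\<forall>F\<in>K. \<forall>G. G face_of F \<longrightarrow> G \<in> K)"

lemma reduced_chains_keys: "subcomplex K \<Longrightarrow> c \<in> reduced_chains K n \<Longrightarrow> Poly_Mapping.keys c \<subseteq> X"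
  by (auto simp: subcomplex_def reduced_chains_def)

lemma reduced_boundaries_subset_cycles:
  assumes "subcomplex K"
  shows "reduced_boundaries \<epsilon> K n \<subseteq> (reduced_cycles \<epsilon> K n :: ('a set \<Rightarrow>\<^sub>0 'k::field) set)"
proof
  fix z :: "'a set \<Rightarrow>\<^sub>0 'k"
  assume "z \<in> reduced_boundaries \<epsilon> K n"
  then obtain c where c: "c \<in> reduced_chains K (n + 1)" and z: "z = reduced_boundary \<epsilon> c"
    by (auto simp: reduced_boundaries_def)
  note cX = reduced_chains_keys[OF assms c]
  have "Poly_Mapping.keys z \<subseteq> {F \<in> K. aff_dim F = n}"
  proof
    fix G assume "G \<in> Poly_Mapping.keys z"
    then obtain F where "F \<in> Poly_Mapping.keys c" "cell_facet G F"
      using keys_reduced_boundary[OF cX] z by blast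
    then show "G \<in> {F \<in> K. aff_dim F = n}"
      using c assms by (auto simp: cell_facet_def reduced_chains_def subcomplex_def)
  qed
  then show "z \<in> reduced_cycles \<epsilon> K n"
    using reduced_boundary_boundary[OF cX] by (simp add: reduced_cycles_def reduced_chains_def z)
qed

lemma reduced_boundaries_diff:
  fixes c d :: "'a set \<Rightarrow>\<^sub>0 'k::field"
  assumes K: "subcomplex K" and "c \<in> reduced_boundaries \<epsilon> K n" and "d \<in> reduced_boundaries \<epsilon> K n"
  shows "c - d \<in> reduced_boundaries \<epsilon> K n"
proof -
  obtain c' d' :: "'a set \<Rightarrow>\<^sub>0 'k"
    where c': "c' \<in> reduced_chains K (n + 1)" "c = reduced_boundary \<epsilon> c'"
      and d': "d' \<in> reduced_chains K (n + 1)" "d = reduced_boundary \<epsilon> d'"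
    using assms(2,3) by (auto simp: reduced_boundaries_def)
  have "c' - d' \<in> reduced_chains K (n + 1)"
    using c'(1) d'(1) Poly_Mapping.keys_diff[of c' d'] by (auto simp: reduced_chains_def)
  moreover have "c - d = reduced_boundary \<epsilon> (c' - d')"
    using c' d' reduced_boundary_diff reduced_chains_keys[OF K] by metis
  ultimately show ?thesis
    by (auto simp: reduced_boundaries_def)
qed

lemma zero_in_reduced_boundaries: "0 \<in> reduced_boundaries \<epsilon> K n"
  unfolding reduced_boundaries_def reduced_chains_def
  by (rule image_eqI[of _ _ 0]) simp_all

text \<open>
  Homology is encoded as a set of classes whose zero class is the set of boundaries; this
  turns its vanishing into an equality of cycles and boundaries.
\<close>

lemma reduced_homology_trivial_iff:
  assumes K: "subcomplex K"
  shows "(reduced_homology \<epsilon> K n :: ('a set \<Rightarrow>\<^sub>0 'k::field) set set) = {reduced_boundaries \<epsilon> K n} \<longleftrightarrow>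
    (reduced_cycles \<epsilon> K n :: ('a set \<Rightarrow>\<^sub>0 'k) set) = reduced_boundaries \<epsilon> K n"
proof -
  let ?Z = "reduced_cycles \<epsilon> K n :: ('a set \<Rightarrow>\<^sub>0 'k) set"
  let ?B = "reduced_boundaries \<epsilon> K n :: ('a set \<Rightarrow>\<^sub>0 'k) set"
  define cls where "cls c = {d \<in> ?Z. c - d \<in> ?B}" for c
  have H: "reduced_homology \<epsilon> K n = cls ` ?Z"
    unfolding reduced_homology_def quotient_def cls_def by auto
  have sub: "?B \<subseteq> ?Z"
    by (rule reduced_boundaries_subset_cycles[OF K])
  have zero: "0 \<in> ?B"
    by (rule zero_in_reduced_boundaries)
  show ?thesis
  proof
    assume "reduced_homology \<epsilon> K n = {?B}"
    then have "cls c = ?B" if "c \<in> ?Z" for c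
      using that H by auto
    moreover have "c \<in> cls c" if "c \<in> ?Z" for c
      using that zero by (simp add: cls_def)
    ultimately show "?Z = ?B"
      using sub by auto
  next
    assume ZB: "?Z = ?B"
    then have "cls c = ?B" if "c \<in> ?Z" for c
      using that reduced_boundaries_diff[OF K] by (auto simp: cls_def)
    then show "reduced_homology \<epsilon> K n = {?B}"
      using H ZB zero by auto
  qed
qed

lemma reduced_boundary_single_vertex:
  fixes t :: "'k::field"
  assumes "v \<in> vertices X"
  shows "reduced_boundary \<epsilon> (Poly_Mapping.single {v} t) = Poly_Mapping.single {} t"
proof -
  have "G = {}" if "cell_facet G {v}" for G
    using that face_of_imp_subset[of G "{v}"] by (auto simp: cell_facet_def subset_singleton_iff)
  moreover have "cell_facet {} {v}"
    by (simp add: cell_facet_def)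
  ultimately have "{G. cell_facet G {v}} = {{}}" by blast
  then show ?thesis
    using signs assms by (simp add: reduced_boundary_def incidence_signs_def)
qed

text \<open>
  Exactness in degrees \<open>\<ge> 0\<close> is what both alternatives have in common. It holds in an empty
  complex, whose chain groups of degree \<open>\<ge> 0\<close> vanish. In a nonempty complex degree -1 comes
  for free, since the empty face is the boundary of any vertex.
\<close>

lemma empty_or_acyclic_iff:
  assumes K: "subcomplex K"
  shows "empty_complex K \<or> acyclic_over TYPE('k::field) \<epsilon> K \<longleftrightarrow>
    (\<forall>n\<ge>0. (reduced_cycles \<epsilon> K n :: ('a set \<Rightarrow>\<^sub>0 'k) set) = reduced_boundaries \<epsilon> K n)"
    (is "_ \<longleftrightarrow> (\<forall>n\<ge>0. ?Z n = ?B n)")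
proof (cases "empty_complex K")
  case True
  have "?Z n \<subseteq> ?B n" if "n \<ge> 0" for n
  proof
    fix c assume "c \<in> ?Z n"
    then have "Poly_Mapping.keys c \<subseteq> {F \<in> K. aff_dim F = n}"
      by (simp add: reduced_cycles_def reduced_chains_def)
    also have "\<dots> = {}"
      using True that by (auto simp: empty_complex_def)
    finally show "c \<in> ?B n"
      using zero_in_reduced_boundaries by simp
  qed
  then show ?thesis
    using True reduced_boundaries_subset_cycles[OF K] by (auto intro!: equalityI)
next
  case False
  then obtain F where F: "F \<in> K" "F \<noteq> {}"
    by (auto simp: empty_complex_def)
  then obtain v where "v extreme_point_of F"
    using cell_has_vertex K by (auto simp: subcomplex_def)
  then have vK: "{v} \<in> K"
    using F K by (auto simp: subcomplex_def face_of_singleton)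
  \<comment> \<open>A chain of degree -1 is a multiple of the empty face, hence the boundary of the same multiple of \<open>v\<close>.\<close>
  have "?Z (-1) \<subseteq> ?B (-1)"
  proof
    fix c assume "c \<in> ?Z (-1)"
    then have "Poly_Mapping.keys c \<subseteq> {F. aff_dim F = -1}"
      by (auto simp: reduced_cycles_def reduced_chains_def)
    then have "Poly_Mapping.keys c \<subseteq> {{}}"
      by (simp flip: aff_dim_empty)
    then have "c = Poly_Mapping.single {} (Poly_Mapping.lookup c {})"
      by (intro poly_mapping_eqI) (auto simp: lookup_single when_def in_keys_iff)
    also have "\<dots> = reduced_boundary \<epsilon> (Poly_Mapping.single {v} (Poly_Mapping.lookup c {}))"
      using vK K by (subst reduced_boundary_single_vertex) (auto simp: vertices_def subcomplex_def)
    also have "\<dots> \<in> ?B (-1)"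
      using vK by (auto simp: reduced_boundaries_def reduced_chains_def)
    finally show "c \<in> ?B (-1)" .
  qed
  then have "?Z (-1) = ?B (-1)"
    using reduced_boundaries_subset_cycles[OF K] by (auto intro!: equalityI)
  moreover have "n = -1 \<or> 0 \<le> n" if "n \<ge> -1" for n :: int
    using that by linarith
  moreover have "n \<ge> -1" if "n \<ge> 0" for n :: int
    using that by linarith
  ultimately show ?thesis
    using False unfolding acyclic_over_def reduced_homology_trivial_iff[OF K] by metis
qed

end

section \<open>Multigraded strands of the cellular complex\<close>

lemma single_sum: "Poly_Mapping.single k (sum f A) = (\<Sum>x\<in>A. Poly_Mapping.single k (f x))"
  by (induction A rule: infinite_finite_induct) (simp_all add: single_add)

text \<open>
  The strand of the cellular complex in multidegree \<open>b\<close> has as basis the elements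
  \<open>x^(b - a_F) F\<close> for the faces \<open>F\<close> whose label \<open>a_F\<close> divides \<open>b\<close>. The
  function \<open>degree_part\<close> extracts the coordinates of a chain with respect to this basis,
  and \<open>homogenize\<close> forms the homogeneous chain with given coordinates. Hence the first is
  a left inverse of the second on chains of faces whose labels divide \<open>b\<close>, and every chain is
  the sum of its homogenized degree parts.
\<close>

definition degree_part ::
  "('a::euclidean_space \<Rightarrow> ('i \<Rightarrow>\<^sub>0 nat)) \<Rightarrow> ('i \<Rightarrow>\<^sub>0 nat) \<Rightarrow>
   ('a set \<Rightarrow>\<^sub>0 ('i, 'k::field) mpolynomial) \<Rightarrow> ('a set \<Rightarrow>\<^sub>0 'k)" where
  "degree_part a b c = Poly_Mapping.mapp (\<lambda>F p. if monom_dvd (face_label a F) b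
     then Poly_Mapping.lookup p (b - face_label a F) else 0) c"

definition homogenize ::
  "('a::euclidean_space \<Rightarrow> ('i \<Rightarrow>\<^sub>0 nat)) \<Rightarrow> ('i \<Rightarrow>\<^sub>0 nat) \<Rightarrow>
   ('a set \<Rightarrow>\<^sub>0 'k::field) \<Rightarrow> ('a set \<Rightarrow>\<^sub>0 ('i, 'k) mpolynomial)" where
  "homogenize a b z = Poly_Mapping.mapp (\<lambda>F. Poly_Mapping.single (b - face_label a F)) z"

lemma lookup_degree_part:
  "Poly_Mapping.lookup (degree_part a b c) F =
     (if monom_dvd (face_label a F) b
      then Poly_Mapping.lookup (Poly_Mapping.lookup c F) (b - face_label a F) else 0)"
  by (auto simp: degree_part_def lookup_mapp when_def in_keys_iff)

lemma lookup_homogenize: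
  "Poly_Mapping.lookup (homogenize a b z) F =
     Poly_Mapping.single (b - face_label a F) (Poly_Mapping.lookup z F)"
  by (auto simp: homogenize_def lookup_mapp when_def in_keys_iff)

lemma keys_degree_part: "Poly_Mapping.keys (degree_part a b c) \<subseteq> Poly_Mapping.keys c"
  by (simp add: degree_part_def keys_mapp_subset)

lemma keys_homogenize: "Poly_Mapping.keys (homogenize a b z) \<subseteq> Poly_Mapping.keys z"
  by (simp add: homogenize_def keys_mapp_subset)

lemma degree_part_zero [simp]: "degree_part a b 0 = 0"
  by (rule poly_mapping_eqI) (simp add: lookup_degree_part)

lemma homogenize_zero [simp]: "homogenize a b 0 = 0"
  by (rule poly_mapping_eqI) (simp add: lookup_homogenize)

lemma degree_part_homogenize:
  assumes "\<And>F. F \<in> Poly_Mapping.keys z \<Longrightarrow> monom_dvd (face_label a F) b"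
  shows "degree_part a b (homogenize a b z) = z"
proof (rule poly_mapping_eqI)
  fix F
  show "Poly_Mapping.lookup (degree_part a b (homogenize a b z)) F = Poly_Mapping.lookup z F"
    using assms[of F]
    by (cases "F \<in> Poly_Mapping.keys z") (auto simp: lookup_degree_part lookup_homogenize in_keys_iff)
qed

text \<open>
  Every coefficient occurs in some strand, so a chain whose degree parts all vanish is zero.
\<close>

lemma lookup_eq_degree_part:
  "Poly_Mapping.lookup (Poly_Mapping.lookup c F) m =
     Poly_Mapping.lookup (degree_part a (face_label a F + m) c) F"
proof -
  have "monom_dvd (face_label a F) (face_label a F + m)"
    by (simp add: monom_dvd_def lookup_add)
  then show ?thesis
    by (simp add: lookup_degree_part)
qed

text \<open>
  The multidegrees in which a chain has a nonzero term. The sum of all its homogeneous parts is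
  thereby a finite sum.
\<close>

definition degree_support ::
  "('a::euclidean_space \<Rightarrow> ('i \<Rightarrow>\<^sub>0 nat)) \<Rightarrow> ('a set \<Rightarrow>\<^sub>0 ('i, 'k::field) mpolynomial) \<Rightarrow>
   ('i \<Rightarrow>\<^sub>0 nat) set" where
  "degree_support a c = (\<Union>F\<in>Poly_Mapping.keys c.
     (\<lambda>m. face_label a F + m) ` Poly_Mapping.keys (Poly_Mapping.lookup c F))"

lemma finite_degree_support: "finite (degree_support a c)"
  by (simp add: degree_support_def)

lemma sum_homogenize_degree_part:
  "(\<Sum>b\<in>degree_support a c. homogenize a b (degree_part a b c)) = c"
proof (intro poly_mapping_eqI)
  fix F m
  let ?l = "face_label a F" and ?p = "Poly_Mapping.lookup c F"
  have dvd: "monom_dvd ?l (?l + m)" for m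
    by (simp add: monom_dvd_def lookup_add)
  have eq: "Poly_Mapping.lookup (Poly_Mapping.single (b - ?l) (Poly_Mapping.lookup (degree_part a b c) F)) m
      = (if b = ?l + m then Poly_Mapping.lookup ?p m else 0)" for b
    using eq_monom_add_iff[of b ?l m]
    by (auto simp: lookup_single when_def lookup_degree_part)
  have "Poly_Mapping.lookup ?p m = 0" if "?l + m \<notin> degree_support a c"
    using that by (force simp: degree_support_def in_keys_iff)
  then show "Poly_Mapping.lookup (Poly_Mapping.lookup
      (\<Sum>b\<in>degree_support a c. homogenize a b (degree_part a b c)) F) m = Poly_Mapping.lookup ?p m"
    by (auto simp: lookup_sum lookup_homogenize eq finite_degree_support)
qed

locale labelled_complex = signed_complex X \<epsilon>
  for X :: "'a::euclidean_space set set" and \<epsilon> :: "'a set \<Rightarrow> 'a set \<Rightarrow> int" +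
  fixes B :: "'i set" and a :: "'a \<Rightarrow> ('i \<Rightarrow>\<^sub>0 nat)"
  assumes labelling: "a \<in> monomial_labellings X B"
begin

lemma face_label_dvd_iff:
  "F \<in> X \<Longrightarrow> monom_dvd (face_label a F) b \<longleftrightarrow> (\<forall>v. v extreme_point_of F \<longrightarrow> monom_dvd (a v) b)"
  using monom_dvd_face_label_iff polytope_cell by blast

lemma face_label_mono:
  assumes "F \<in> X" and "G face_of F"
  shows "monom_dvd (face_label a G) (face_label a F)"
proof -
  have "monom_dvd (face_label a F) (face_label a F)"
    by (simp add: monom_dvd_def)
  then show ?thesis
    using assms face_in_X[OF assms] by (simp add: face_label_dvd_iff extreme_point_of_face)
qed

lemma face_label_in:
  assumes "F \<in> X"
  shows "face_label a F \<in> monomials_in B"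
proof -
  have "Poly_Mapping.lookup (a v) i = 0" if "v extreme_point_of F" "i \<notin> B" for v i
    using labelling extreme_point_is_vertex[OF complex assms that(1)] that(2)
    by (fastforce simp: monomial_labellings_def monomials_in_def in_keys_iff PiE_iff)
  then have "Poly_Mapping.lookup (face_label a F) i = 0" if "i \<notin> B" for i
    using that finite_extreme_points[OF polytope_cell[OF assms]]
    by (auto simp: lookup_face_label[OF polytope_cell[OF assms]] intro!: Max_eqI)
  then show ?thesis
    unfolding monomials_in_def by (metis in_keys_iff mem_Collect_eq subsetI)
qed

lemma sublevel_complex_eq:
  "sublevel_complex X a b = {F \<in> X. monom_dvd (face_label a F) b}"
  using extreme_point_is_vertex[OF complex]
  by (auto simp: sublevel_complex_def induced_subcomplex_def face_label_dvd_iff)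

lemma subcomplex_sublevel: "subcomplex (sublevel_complex X a b)"
  using face_label_mono monom_dvd_trans face_in_X
  by (fastforce simp: subcomplex_def sublevel_complex_eq)

lemma lookup_cellular_differential:
  fixes c :: "'a set \<Rightarrow>\<^sub>0 ('i, 'k::field) mpolynomial"
  assumes "Poly_Mapping.keys c \<subseteq> X"
  shows "Poly_Mapping.lookup (cellular_differential \<epsilon> a c) G =
    (\<Sum>F | F \<in> X \<and> cell_facet G F.
       Poly_Mapping.single (face_label a F - face_label a G) (of_int (\<epsilon> G F)) * Poly_Mapping.lookup c F)"
  unfolding cellular_differential_def of_int_mult_monom_poly
  by (rule lookup_sum_boundary[OF finite_X finite_facets assms]) (auto simp: in_keys_iff)

text \<open>
  The differential preserves multidegrees: the factor \<open>x^(a_F - a_G)\<close> carries the basis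
  element of \<open>F\<close> in a strand to the one of \<open>G\<close>, up to sign. So in coordinates it
  is the reduced boundary, here for the passage to coordinates and in the next lemma for the
  passage back.
\<close>

lemma degree_part_differential:
  fixes c :: "'a set \<Rightarrow>\<^sub>0 ('i, 'k::field) mpolynomial"
  assumes c: "Poly_Mapping.keys c \<subseteq> X"
  shows "degree_part a b (cellular_differential \<epsilon> a c) = reduced_boundary \<epsilon> (degree_part a b c)"
proof (rule poly_mapping_eqI)
  fix G
  let ?l = "face_label a"
  have cX: "Poly_Mapping.keys (degree_part a b c) \<subseteq> X"
    using c keys_degree_part by blast
  have mono: "monom_dvd (?l G) (?l F)" if "F \<in> X" "cell_facet G F" for F
    using that face_label_mono by (simp add: cell_facet_def)
  show "Poly_Mapping.lookup (degree_part a b (cellular_differential \<epsilon> a c)) G =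
      Poly_Mapping.lookup (reduced_boundary \<epsilon> (degree_part a b c)) G"
  proof (cases "monom_dvd (?l G) b")
    case True
    have "Poly_Mapping.lookup (Poly_Mapping.single (?l F - ?l G) (of_int (\<epsilon> G F)) *
          Poly_Mapping.lookup c F) (b - ?l G) =
        of_int (\<epsilon> G F) * Poly_Mapping.lookup (degree_part a b c) F"
      if "F \<in> X" "cell_facet G F" for F
      using monom_dvd_diff_iff[OF mono[OF that] True] monom_diff_diff(1)[OF mono[OF that], of b]
      by (simp add: lookup_single_mult lookup_degree_part)
    then show ?thesis
      using True
      by (simp add: lookup_degree_part[of a b _ G] lookup_cellular_differential[OF c]
          lookup_reduced_boundary[OF cX] lookup_sum)
  next
    case False
    then have "Poly_Mapping.lookup (degree_part a b c) F = 0" if "F \<in> X" "cell_facet G F" for F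
      using mono[OF that] monom_dvd_trans by (auto simp: lookup_degree_part)
    then show ?thesis
      using False by (simp add: lookup_degree_part[of a b _ G] lookup_reduced_boundary[OF cX])
  qed
qed

lemma differential_homogenize:
  fixes z :: "'a set \<Rightarrow>\<^sub>0 'k::field"
  assumes z: "Poly_Mapping.keys z \<subseteq> sublevel_complex X a b"
  shows "cellular_differential \<epsilon> a (homogenize a b z) = homogenize a b (reduced_boundary \<epsilon> z)"
proof (rule poly_mapping_eqI)
  fix G
  let ?l = "face_label a"
  have zX: "Poly_Mapping.keys z \<subseteq> X"
    using z by (auto simp: sublevel_complex_eq)
  then have hX: "Poly_Mapping.keys (homogenize a b z) \<subseteq> X"
    using keys_homogenize by blast
  have "Poly_Mapping.single (?l F - ?l G) (of_int (\<epsilon> G F)) * Poly_Mapping.lookup (homogenize a b z) F =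
      Poly_Mapping.single (b - ?l G) (of_int (\<epsilon> G F) * Poly_Mapping.lookup z F)"
    if F: "F \<in> X" "cell_facet G F" for F
  proof (cases "F \<in> Poly_Mapping.keys z")
    case True
    then have "monom_dvd (?l F) b"
      using z by (auto simp: sublevel_complex_eq)
    moreover have "monom_dvd (?l G) (?l F)"
      using F face_label_mono by (simp add: cell_facet_def)
    ultimately show ?thesis
      by (simp add: lookup_homogenize mult_single monom_diff_diff(2))
  qed (simp add: lookup_homogenize in_keys_iff)
  then show "Poly_Mapping.lookup (cellular_differential \<epsilon> a (homogenize a b z)) G =
      Poly_Mapping.lookup (homogenize a b (reduced_boundary \<epsilon> z)) G"
    by (simp add: lookup_cellular_differential[OF hX] lookup_homogenize[of a b _ G]
        lookup_reduced_boundary[OF zX] single_sum)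
qed

section \<open>Exactness degree by degree\<close>

lemma cellular_module_keys: "c \<in> cellular_module X B n \<Longrightarrow> Poly_Mapping.keys c \<subseteq> X"
  by (auto simp: cellular_module_def)

lemma degree_part_in:
  assumes "c \<in> cellular_module X B n"
  shows "degree_part a b c \<in> reduced_chains (sublevel_complex X a b) n"
proof -
  have "F \<in> sublevel_complex X a b \<and> aff_dim F = n"
    if "F \<in> Poly_Mapping.keys (degree_part a b c)" for F
    using that assms keys_degree_part[of a b c]
    by (auto simp: cellular_module_def sublevel_complex_eq lookup_degree_part in_keys_iff split: if_splits)
  then show ?thesis
    by (auto simp: reduced_chains_def)
qed

lemma homogenize_in:
  assumes "b \<in> monomials_in B" and "z \<in> reduced_chains (sublevel_complex X a b) n"
  shows "homogenize a b z \<in> cellular_module X B n"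
  using assms keys_homogenize[of a b z]
  by (auto simp: cellular_module_def reduced_chains_def sublevel_complex_eq lookup_homogenize
      intro!: mpoly_ring_single_closed monomials_in_diff)

lemma degree_support_in:
  assumes "c \<in> cellular_module X B n"
  shows "degree_support a c \<subseteq> monomials_in B"
  using assms face_label_in
  by (force simp: degree_support_def cellular_module_def mpoly_ring_def intro!: monomials_in_add)

lemma cellular_differential_in:
  assumes c: "c \<in> cellular_module X B (n + 1)"
  shows "cellular_differential \<epsilon> a c \<in> cellular_module X B n"
proof -
  note cX = cellular_module_keys[OF c]
  have "G \<in> X \<and> aff_dim G = n" if "G \<in> Poly_Mapping.keys (cellular_differential \<epsilon> a c)" for G
  proof -
    have "Poly_Mapping.lookup (cellular_differential \<epsilon> a c) G \<noteq> 0"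
      using that by (simp add: in_keys_iff)
    then obtain F where F: "F \<in> X" "cell_facet G F" "Poly_Mapping.lookup c F \<noteq> 0"
      unfolding lookup_cellular_differential[OF cX] 
      by (rule sum.not_neutral_contains_not_neutral)
        (metis (mono_tags, lifting) mem_Collect_eq mult_zero_right)
    then show ?thesis
      using c facet_in_X by (auto simp: cellular_module_def in_keys_iff cell_facet_def)
  qed
  moreover have "Poly_Mapping.lookup (cellular_differential \<epsilon> a c) G \<in> carrier (mpoly_ring B)" for G
    unfolding lookup_cellular_differential[OF cX]
    using c by (intro mpoly_ring_sum_closed mpoly_ring_mult_closed mpoly_ring_single_closed
        monomials_in_diff) (auto simp: cellular_module_def intro: face_label_in)
  ultimately show ?thesis
    by (auto simp: cellular_module_def)
qed

lemma cellular_differential_differential: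
  fixes c :: "'a set \<Rightarrow>\<^sub>0 ('i, 'k::field) mpolynomial"
  assumes c: "c \<in> cellular_module X B (n + 1)"
  shows "cellular_differential \<epsilon> a (cellular_differential \<epsilon> a c) = 0"
proof (intro poly_mapping_eqI)
  fix F m
  have "degree_part a b (cellular_differential \<epsilon> a (cellular_differential \<epsilon> a c)) = 0" for b
    using cellular_module_keys[OF c] cellular_module_keys[OF cellular_differential_in[OF c]]
      keys_degree_part[of a b c]
    by (simp add: degree_part_differential reduced_boundary_boundary subset_trans)
  then show "Poly_Mapping.lookup (Poly_Mapping.lookup
      (cellular_differential \<epsilon> a (cellular_differential \<epsilon> a c)) F) m =
      Poly_Mapping.lookup (Poly_Mapping.lookup 0 F) m"
    by (simp add: lookup_eq_degree_part[where a = a])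
qed

lemma cellular_differential_sum:
  fixes f :: "'b \<Rightarrow> 'a set \<Rightarrow>\<^sub>0 ('i, 'k::field) mpolynomial"
  assumes "\<And>x. x \<in> D \<Longrightarrow> Poly_Mapping.keys (f x) \<subseteq> X"
  shows "cellular_differential \<epsilon> a (sum f D) = (\<Sum>x\<in>D. cellular_differential \<epsilon> a (f x))"
proof (rule poly_mapping_eqI)
  fix G
  have keys: "Poly_Mapping.keys (sum f D) \<subseteq> X"
    using assms Poly_Mapping.keys_sum[of f D] by blast
  show "Poly_Mapping.lookup (cellular_differential \<epsilon> a (sum f D)) G =
      Poly_Mapping.lookup (\<Sum>x\<in>D. cellular_differential \<epsilon> a (f x)) G"
    unfolding lookup_cellular_differential[OF keys] lookup_sum sum_distrib_left
    by (subst sum.swap) (simp add: lookup_cellular_differential assms)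
qed

lemma cellular_module_sum:
  assumes "\<And>x. x \<in> D \<Longrightarrow> f x \<in> cellular_module X B n"
  shows "sum f D \<in> cellular_module X B n"
proof -
  have "Poly_Mapping.keys (sum f D) \<subseteq> (\<Union>x\<in>D. Poly_Mapping.keys (f x))"
    by (rule Poly_Mapping.keys_sum)
  then show ?thesis
    using assms by (fastforce simp: cellular_module_def lookup_sum intro!: mpoly_ring_sum_closed)
qed

text \<open>
  Exactness can be tested one multidegree at a time, because the strand of the cellular complex
  in multidegree \<open>b\<close> is the reduced chain complex of the subcomplex below \<open>b\<close>. A cycle of
  the subcomplex is homogenized, bounded in the cellular complex, and the bounding chain is cut
  down to degree \<open>b\<close>. Conversely, a cycle of the cellular complex is bounded by the sum of
  homogenized chains that bound its degree parts.
\<close>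

lemma cellular_exact_iff:
  "{c \<in> cellular_module X B n. (cellular_differential \<epsilon> a c :: 'a set \<Rightarrow>\<^sub>0 ('i, 'k::field) mpolynomial) = 0} =
     cellular_differential \<epsilon> a ` cellular_module X B (n + 1) \<longleftrightarrow>
   (\<forall>b\<in>monomials_in B. (reduced_cycles \<epsilon> (sublevel_complex X a b) n :: ('a set \<Rightarrow>\<^sub>0 'k) set) =
     reduced_boundaries \<epsilon> (sublevel_complex X a b) n)"
  (is "?Z = ?d ` ?M \<longleftrightarrow> (\<forall>b\<in>_. ?z b = ?b b)")
proof
  assume exact: "?Z = ?d ` ?M"
  show "\<forall>b\<in>monomials_in B. ?z b = ?b b"
  proof (intro ballI equalityI subsetI)
    fix b z assume b: "b \<in> monomials_in B" and "z \<in> ?z b"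
    then have z: "z \<in> reduced_chains (sublevel_complex X a b) n" "reduced_boundary \<epsilon> z = 0"
      by (simp_all add: reduced_cycles_def)
    then have zK: "Poly_Mapping.keys z \<subseteq> sublevel_complex X a b"
      by (auto simp: reduced_chains_def)
    have "homogenize a b z \<in> ?Z"
      using homogenize_in[OF b z(1)] differential_homogenize[OF zK] z(2) by simp
    then obtain e where e: "e \<in> ?M" "homogenize a b z = ?d e"
      using exact by auto
    have "z = degree_part a b (homogenize a b z)"
      using zK by (subst degree_part_homogenize) (auto simp: sublevel_complex_eq)
    also have "\<dots> = reduced_boundary \<epsilon> (degree_part a b e)"
      using e(2) degree_part_differential[OF cellular_module_keys[OF e(1)]] by simp
    finally show "z \<in> ?b b"
      using degree_part_in[OF e(1)] by (auto simp: reduced_boundaries_def)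
  next
    fix b z assume "z \<in> ?b b"
    then show "z \<in> ?z b"
      using reduced_boundaries_subset_cycles[OF subcomplex_sublevel] by blast
  qed
next
  assume acyclic: "\<forall>b\<in>monomials_in B. ?z b = ?b b"
  show "?Z = ?d ` ?M"
  proof (intro equalityI subsetI)
    fix c assume "c \<in> ?Z"
    then have c: "c \<in> cellular_module X B n" "?d c = 0" by auto
    \<comment> \<open>Each degree part of a cycle is a cycle of a sublevel complex, hence a boundary there.\<close>
    have "\<exists>e. e \<in> reduced_chains (sublevel_complex X a b) (n + 1) \<and>
        reduced_boundary \<epsilon> e = degree_part a b c" if "b \<in> degree_support a c" for b
    proof -
      have "reduced_boundary \<epsilon> (degree_part a b c) = 0"
        using degree_part_differential[OF cellular_module_keys[OF c(1)], of b] c(2) by simp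
      then have "degree_part a b c \<in> ?z b"
        using degree_part_in[OF c(1)] by (simp add: reduced_cycles_def)
      moreover have "b \<in> monomials_in B"
        using that degree_support_in[OF c(1)] by blast
      ultimately have "degree_part a b c \<in> ?b b"
        using acyclic by blast
      then show ?thesis
        by (auto simp: reduced_boundaries_def)
    qed
    then obtain e where e: "e b \<in> reduced_chains (sublevel_complex X a b) (n + 1)"
        "reduced_boundary \<epsilon> (e b) = degree_part a b c" if "b \<in> degree_support a c" for b
      by metis
    have hom: "homogenize a b (e b) \<in> ?M" if "b \<in> degree_support a c" for b
      using that homogenize_in e(1) degree_support_in[OF c(1)] by blast
    have "?d (\<Sum>b\<in>degree_support a c. homogenize a b (e b)) =
        (\<Sum>b\<in>degree_support a c. ?d (homogenize a b (e b)))"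
      using hom cellular_module_keys by (intro cellular_differential_sum) blast
    also have "\<dots> = (\<Sum>b\<in>degree_support a c. homogenize a b (degree_part a b c))"
    proof (rule sum.cong[OF refl])
      fix b assume b: "b \<in> degree_support a c"
      then have "Poly_Mapping.keys (e b) \<subseteq> sublevel_complex X a b"
        using e(1) by (auto simp: reduced_chains_def)
      then show "?d (homogenize a b (e b)) = homogenize a b (degree_part a b c)"
        using e(2)[OF b] by (simp add: differential_homogenize)
    qed
    also have "\<dots> = c"
      by (rule sum_homogenize_degree_part)
    finally have "c = ?d (\<Sum>b\<in>degree_support a c. homogenize a b (e b))" ..
    moreover have "(\<Sum>b\<in>degree_support a c. homogenize a b (e b)) \<in> ?M"
      by (rule cellular_module_sum) (rule hom)
    ultimately show "c \<in> ?d ` ?M"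
      by (rule image_eqI)
  next
    fix c assume "c \<in> ?d ` ?M"
    then show "c \<in> ?Z"
      using cellular_differential_in cellular_differential_differential by auto
  qed
qed

section \<open>The ideal of the labels and the criterion of Bayer and Sturmfels\<close>

lemma lookup_differential_empty_face:
  fixes c :: "'a set \<Rightarrow>\<^sub>0 ('i, 'k::field) mpolynomial"
  assumes "Poly_Mapping.keys c \<subseteq> X"
  shows "Poly_Mapping.lookup (cellular_differential \<epsilon> a c) {} =
    (\<Sum>v\<in>vertices X. monom_poly (a v) * Poly_Mapping.lookup c {v})"
proof -
  have "{F. F \<in> X \<and> cell_facet {} F} = (\<lambda>v. {v}) ` vertices X"
    by (auto simp: cell_facet_def aff_dim_eq_0 vertices_def)
  then have "Poly_Mapping.lookup (cellular_differential \<epsilon> a c) {} =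
    (\<Sum>v\<in>vertices X. Poly_Mapping.single (a v) (of_int (\<epsilon> {} {v})) * Poly_Mapping.lookup c {v})"
    by (simp add: lookup_cellular_differential[OF assms] sum.reindex inj_on_def)
  also have "\<dots> = (\<Sum>v\<in>vertices X. monom_poly (a v) * Poly_Mapping.lookup c {v})"
    using signs by (simp add: incidence_signs_def monom_poly_def)
  finally show ?thesis .
qed

lemma vertex_label_in: "v \<in> vertices X \<Longrightarrow> a v \<in> monomials_in B"
  using face_label_in[of "{v}"] by (simp add: vertices_def)

text \<open>
  The ideal generated by the labels, written out as the set of combinations of finitely many
  generators.
\<close>

definition label_span :: "('i, 'k::field) mpolynomial set" where
  "label_span = {\<Sum>v\<in>vertices X. monom_poly (a v) * q v | q. \<forall>v. q v \<in> carrier (mpoly_ring B)}"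

text \<open>
  The coefficients at the vertices are arbitrary polynomials, and each vertex is mapped to its
  label because its incidence with the empty face is 1.
\<close>

lemma image_differential_eq_label_span:
  "(\<lambda>c. Poly_Mapping.lookup c {}) ` cellular_differential \<epsilon> a ` cellular_module X B 0 =
     (label_span :: ('i, 'k::field) mpolynomial set)"
proof (intro equalityI subsetI)
  fix p :: "('i, 'k) mpolynomial"
  assume "p \<in> (\<lambda>c. Poly_Mapping.lookup c {}) ` cellular_differential \<epsilon> a ` cellular_module X B 0"
  then obtain c where c: "c \<in> cellular_module X B 0"
    and p: "p = Poly_Mapping.lookup (cellular_differential \<epsilon> a c) {}"
    by auto
  show "p \<in> label_span"
    unfolding label_span_def p lookup_differential_empty_face[OF cellular_module_keys[OF c]]
    using c by (auto simp: cellular_module_def intro!: exI[of _ "\<lambda>v. Poly_Mapping.lookup c {v}"])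
next
  fix p :: "('i, 'k) mpolynomial"
  assume "p \<in> label_span"
  then obtain q where q: "\<And>v. q v \<in> carrier (mpoly_ring B)"
    and p: "p = (\<Sum>v\<in>vertices X. monom_poly (a v) * q v)"
    by (auto simp: label_span_def)
  define c where "c = (\<Sum>v\<in>vertices X. Poly_Mapping.single {v} (q v))"
  have "Poly_Mapping.single {v} (q v) \<in> cellular_module X B 0" if "v \<in> vertices X" for v
    using that q by (auto simp: cellular_module_def vertices_def lookup_single when_def
        mpoly_ring_zero_closed)
  then have c: "c \<in> cellular_module X B 0"
    unfolding c_def by (rule cellular_module_sum)
  have "Poly_Mapping.lookup c {v} = q v" if "v \<in> vertices X" for v
    using that finite_vertices by (simp add: c_def lookup_sum lookup_single when_def)
  then have "Poly_Mapping.lookup (cellular_differential \<epsilon> a c) {} = p"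
    by (simp add: lookup_differential_empty_face[OF cellular_module_keys[OF c]] p)
  then show "p \<in> (\<lambda>c. Poly_Mapping.lookup c {}) ` cellular_differential \<epsilon> a ` cellular_module X B 0"
    using c by blast
qed

text \<open>
  With the previous lemma: the cokernel of the last differential is \<open>S/I\<close> for every
  labelling, so that being a resolution is a matter of exactness in degrees \<open>\<ge> 0\<close> only.
\<close>

lemma label_ideal_eq_span: "label_ideal X B a = (label_span :: ('i, 'k::field) mpolynomial set)"
proof -
  let ?R = "mpoly_ring B :: ('i, 'k) mpolynomial ring"
  let ?J = "label_span :: ('i, 'k) mpolynomial set"
  let ?gens = "(\<lambda>v. monom_poly (a v) :: ('i, 'k) mpolynomial) ` vertices X"
  interpret R: cring ?R by (rule cring_mpoly_ring)
  have ops: "x \<oplus>\<^bsub>?R\<^esub> y = x + y" "x \<otimes>\<^bsub>?R\<^esub> y = x * y" "\<zero>\<^bsub>?R\<^esub> = 0" "\<one>\<^bsub>?R\<^esub> = 1" for x y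
    by (simp_all add: mpoly_ring_def)
  have monom: "monom_poly (a v) \<in> carrier ?R" if "v \<in> vertices X" for v
    unfolding monom_poly_def using that by (intro mpoly_ring_single_closed vertex_label_in)
  have J_carrier: "?J \<subseteq> carrier ?R"
    by (auto simp: label_span_def intro!: mpoly_ring_sum_closed mpoly_ring_mult_closed monom)
  have J_mult: "x * p \<in> ?J" if p: "p \<in> ?J" and x: "x \<in> carrier ?R" for p x
  proof -
    obtain q where q: "\<And>v. q v \<in> carrier ?R" "p = (\<Sum>v\<in>vertices X. monom_poly (a v) * q v)"
      using p by (auto simp: label_span_def)
    have "x * p = (\<Sum>v\<in>vertices X. monom_poly (a v) * (x * q v))"
      by (simp add: q(2) sum_distrib_left mult_ac)
    then show ?thesis
      using q(1) x by (auto simp: label_span_def intro!: exI[of _ "\<lambda>v. x * q v"] mpoly_ring_mult_closed)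
  qed
  have J_add: "p + p' \<in> ?J" if p: "p \<in> ?J" and p': "p' \<in> ?J" for p p'
  proof -
    obtain q where q: "\<And>v. q v \<in> carrier ?R" "p = (\<Sum>v\<in>vertices X. monom_poly (a v) * q v)"
      using p by (auto simp: label_span_def)
    obtain q' where q': "\<And>v. q' v \<in> carrier ?R" "p' = (\<Sum>v\<in>vertices X. monom_poly (a v) * q' v)"
      using p' by (auto simp: label_span_def)
    have "p + p' = (\<Sum>v\<in>vertices X. monom_poly (a v) * (q v + q' v))"
      by (simp add: q(2) q'(2) sum.distrib distrib_left)
    then show ?thesis
      using q(1) q'(1)
      by (auto simp: label_span_def intro!: exI[of _ "\<lambda>v. q v + q' v"] mpoly_ring_add_closed)
  qed
  have J_zero: "0 \<in> ?J"
    by (auto simp: label_span_def intro!: exI[of _ "\<lambda>_. 0"] mpoly_ring_zero_closed)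
  have one: "1 \<in> carrier ?R"
    using R.one_closed by (simp add: ops)
  have J_uminus: "\<ominus>\<^bsub>?R\<^esub> p \<in> ?J" if "p \<in> ?J" for p
  proof -
    have "\<ominus>\<^bsub>?R\<^esub> p = - p"
      using that J_carrier by (intro R.minus_equality) (auto simp: ops mpoly_ring_uminus_closed)
    also have "\<dots> = (- 1) * p" by simp
    also have "\<dots> \<in> ?J"
      using that one by (intro J_mult mpoly_ring_uminus_closed)
    finally show ?thesis .
  qed
  have "subgroup ?J (add_monoid ?R)"
    using J_carrier J_add J_zero J_uminus
    by (intro group.subgroupI[OF R.a_group]) (auto simp: ops a_inv_def)
  then have "ideal ?J ?R"
    using J_mult by (intro idealI R.ring_axioms) (simp_all add: ops mult.commute)
  moreover have "?gens \<subseteq> ?J"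
  proof
    fix p assume "p \<in> ?gens"
    then obtain v where v: "v \<in> vertices X" "p = monom_poly (a v)" by blast
    have "p = (\<Sum>w\<in>vertices X. monom_poly (a w) * (if w = v then 1 else 0))"
      using v finite_vertices by (simp add: if_distrib cong: if_cong)
    then show "p \<in> ?J"
      using one by (auto simp: label_span_def mpoly_ring_zero_closed
          intro!: exI[of _ "\<lambda>w. if w = v then 1 else 0"])
  qed
  moreover have "?J \<subseteq> I" if I: "ideal I ?R" and gens: "?gens \<subseteq> I" for I
  proof
    fix p assume "p \<in> ?J"
    then obtain q where q: "\<And>v. q v \<in> carrier ?R" "p = (\<Sum>v\<in>vertices X. monom_poly (a v) * q v)"
      by (auto simp: label_span_def)
    interpret I: ideal I ?R by (rule I)
    have "(\<Sum>v\<in>V. monom_poly (a v) * q v) \<in> I" if "V \<subseteq> vertices X" for V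
      using that
    proof (induction V rule: infinite_finite_induct)
      case (insert v V)
      have "monom_poly (a v) * q v \<in> I"
        using I.I_r_closed[of "monom_poly (a v)" "q v"] gens insert.prems q(1) by (auto simp: ops)
      then show ?case
        using insert I.a_closed by (simp add: ops)
    qed (use I.zero_closed in \<open>simp_all add: ops\<close>)
    then show "p \<in> I"
      using q(2) by blast
  qed
  ultimately show ?thesis
    unfolding label_ideal_def genideal_def by blast
qed

text \<open>
  The criterion of Bayer and Sturmfels, valid for arbitrary monomial labels.
\<close>

theorem gives_cellular_resolution_iff:
  "gives_cellular_resolution TYPE('k::field) \<epsilon> X B a \<longleftrightarrow>
     (\<forall>b\<in>monomials_in B. empty_complex (sublevel_complex X a b) \<or>
        acyclic_over TYPE('k) \<epsilon> (sublevel_complex X a b))"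
  unfolding gives_cellular_resolution_def image_differential_eq_label_span label_ideal_eq_span
    cellular_exact_iff empty_or_acyclic_iff[OF subcomplex_sublevel]
  by blast

end

section \<open>Squarefree labellings and families of induced subcomplexes\<close>

lemma lookup_sum_single_one:
  assumes "finite A"
  shows "Poly_Mapping.lookup (\<Sum>i\<in>A. Poly_Mapping.single i (1::nat)) j = (if j \<in> A then 1 else 0)"
  using assms by (simp add: lookup_sum lookup_single when_def)

lemma keys_all_ones: "finite A \<Longrightarrow> Poly_Mapping.keys (all_ones A) = A"
  by (auto simp: all_ones_def in_keys_iff lookup_sum_single_one simp del: One_nat_def split: if_splits)

text \<open>
  Exponents at most 1 make divisibility a question of which variables occur: multiplicities
  in \<open>b\<close> beyond 1 have no effect.
\<close>

lemma squarefree_dvd_iff: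
  assumes "squarefree_monom m" and "m \<in> monomials_in B"
  shows "monom_dvd m b \<longleftrightarrow> (\<forall>i\<in>B - Poly_Mapping.keys b. Poly_Mapping.lookup m i = 0)"
proof -
  have "Poly_Mapping.lookup m i \<le> Poly_Mapping.lookup b i \<longleftrightarrow>
      (i \<in> B - Poly_Mapping.keys b \<longrightarrow> Poly_Mapping.lookup m i = 0)" for i
  proof (cases "i \<in> B \<and> Poly_Mapping.lookup b i = 0")
    case False
    have "Poly_Mapping.lookup m i \<le> 1"
      using assms(1) by (simp add: squarefree_monom_def)
    moreover have "Poly_Mapping.lookup m i = 0" if "i \<notin> B"
      using assms(2) that by (auto simp: monomials_in_def in_keys_iff)
    ultimately have "Poly_Mapping.lookup m i \<le> Poly_Mapping.lookup b i"
      using False by (cases "i \<in> B") auto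
    then show ?thesis
      using False by (auto simp: in_keys_iff)
  qed (auto simp: in_keys_iff)
  then show ?thesis
    by (auto simp: monom_dvd_def)
qed

definition squarefree_labellings ::
  "'a::euclidean_space set set \<Rightarrow> 'i set \<Rightarrow> ('a \<Rightarrow> ('i \<Rightarrow>\<^sub>0 nat)) set" where
  "squarefree_labellings X B = {a \<in> monomial_labellings X B. \<forall>v\<in>vertices X. squarefree_monom (a v)}"

lemma squarefree_labelling_dvd_iff:
  assumes "a \<in> squarefree_labellings X B" and "v \<in> vertices X"
  shows "monom_dvd (a v) b \<longleftrightarrow> (\<forall>i\<in>B - Poly_Mapping.keys b. Poly_Mapping.lookup (a v) i = 0)"
  using assms by (intro squarefree_dvd_iff)
    (auto simp: squarefree_labellings_def monomial_labellings_def)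

lemma family_of_labelling_eq:
  assumes a: "a \<in> squarefree_labellings X B" and B: "finite B" and i: "i \<in> B"
  shows "family_of_labelling X B a i =
    induced_subcomplex X {v \<in> vertices X. Poly_Mapping.lookup (a v) i = 0}"
proof -
  have "Poly_Mapping.keys (all_ones B - Poly_Mapping.single i 1) = B - {i}"
    by (auto simp: all_ones_def in_keys_iff lookup_minus lookup_sum_single_one[OF B]
        lookup_single when_def simp del: One_nat_def split: if_splits)
  then have "B - Poly_Mapping.keys (all_ones B - Poly_Mapping.single i 1) = {i}"
    using i by auto
  then have "{v \<in> vertices X. monom_dvd (a v) (all_ones B - Poly_Mapping.single i 1)} =
      {v \<in> vertices X. Poly_Mapping.lookup (a v) i = 0}"
    using squarefree_labelling_dvd_iff[OF a] by auto
  then show ?thesis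
    using i by (simp add: family_of_labelling_def sublevel_complex_def)
qed

text \<open>
  A face lies below \<open>b\<close> iff no variable missing from \<open>b\<close> divides the label of one of
  its vertices, that is, iff it belongs to the member of the family of each missing variable.
  Intersecting with \<open>X\<close> matters when no variable is missing.
\<close>

lemma sublevel_complex_eq_Inter:
  assumes X: "polyhedral_complex X" and a: "a \<in> squarefree_labellings X B" and B: "finite B"
  shows "sublevel_complex X a b = X \<inter> (\<Inter>i\<in>B - Poly_Mapping.keys b. family_of_labelling X B a i)"
proof -
  have "(\<Inter>i\<in>B - Poly_Mapping.keys b. family_of_labelling X B a i) =
      (\<Inter>i\<in>B - Poly_Mapping.keys b. induced_subcomplex X {v \<in> vertices X. Poly_Mapping.lookup (a v) i = 0})"
    using family_of_labelling_eq[OF a B] by simp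
  moreover have "{v \<in> vertices X. monom_dvd (a v) b} =
      {v \<in> vertices X. \<forall>i\<in>B - Poly_Mapping.keys b. Poly_Mapping.lookup (a v) i = 0}"
    using squarefree_labelling_dvd_iff[OF a] by auto
  moreover have "v \<in> vertices X" if "F \<in> X" "v extreme_point_of F" for F v
    using extreme_point_is_vertex X that by blast
  ultimately show ?thesis
    by (auto simp: sublevel_complex_def induced_subcomplex_def)
qed

lemma vertices_induced_subcomplex:
  "V \<subseteq> vertices X \<Longrightarrow> vertices (induced_subcomplex X V) = V"
  by (auto simp: vertices_def induced_subcomplex_def)

lemma family_of_labelling_in:
  assumes "a \<in> squarefree_labellings X B" and "finite B"
  shows "family_of_labelling X B a \<in> B \<rightarrow>\<^sub>E induced_subcomplexes X"
proof (rule PiE_I)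
  fix i assume "i \<in> B"
  then show "family_of_labelling X B a i \<in> induced_subcomplexes X"
    by (auto simp: family_of_labelling_eq[OF assms] induced_subcomplexes_def)
qed (simp add: family_of_labelling_def)

lemma lookup_labelling_of_family:
  assumes "finite B" and "v \<in> vertices X"
  shows "Poly_Mapping.lookup (labelling_of_family X B C v) i =
    (if i \<in> B \<and> v \<notin> vertices (C i) then 1 else 0)"
  using assms by (simp add: labelling_of_family_def lookup_sum_single_one del: One_nat_def)

lemma labelling_of_family_in:
  assumes B: "finite B"
  shows "labelling_of_family X B C \<in> squarefree_labellings X B"
proof -
  have "labelling_of_family X B C v \<in> monomials_in B" if "v \<in> vertices X" for v
    using that by (auto simp: monomials_in_def in_keys_iff lookup_labelling_of_family[OF B] split: if_splits)
  then have "labelling_of_family X B C \<in> monomial_labellings X B"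
    unfolding monomial_labellings_def by (rule PiE_I) (simp_all add: labelling_of_family_def)
  then show ?thesis
    by (simp add: squarefree_labellings_def squarefree_monom_def lookup_labelling_of_family[OF B])
qed

text \<open>
  This direction needs squarefreeness: the family records only which variables divide a label.
\<close>

lemma labelling_of_family_of_labelling:
  assumes a: "a \<in> squarefree_labellings X B" and B: "finite B"
  shows "labelling_of_family X B (family_of_labelling X B a) = a"
proof (rule PiE_ext)
  show "labelling_of_family X B (family_of_labelling X B a) \<in> vertices X \<rightarrow>\<^sub>E monomials_in B"
    and a_in: "a \<in> vertices X \<rightarrow>\<^sub>E monomials_in B"
    using labelling_of_family_in[OF B, of X "family_of_labelling X B a"] a
    by (simp_all add: squarefree_labellings_def monomial_labellings_def)
  fix v assume v: "v \<in> vertices X"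
  show "labelling_of_family X B (family_of_labelling X B a) v = a v"
  proof (rule poly_mapping_eqI)
    fix i
    have "Poly_Mapping.lookup (a v) i \<le> 1"
      using a v by (simp add: squarefree_labellings_def squarefree_monom_def)
    moreover have "Poly_Mapping.lookup (a v) i = 0" if "i \<notin> B"
      using PiE_mem[OF a_in v] that by (auto simp: monomials_in_def subset_eq simp flip: not_in_keys_iff_lookup_eq_zero)
    moreover have "v \<in> vertices (family_of_labelling X B a i) \<longleftrightarrow> Poly_Mapping.lookup (a v) i = 0"
      if "i \<in> B"
      using v by (simp add: family_of_labelling_eq[OF a B that] vertices_induced_subcomplex)
    ultimately show "Poly_Mapping.lookup (labelling_of_family X B (family_of_labelling X B a) v) i =
        Poly_Mapping.lookup (a v) i"
      by (auto simp: lookup_labelling_of_family[OF B v])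
  qed
qed

text \<open>
  An induced subcomplex is determined by its vertices, and the labels record exactly which
  vertices are missing from each member of the family.
\<close>

lemma family_of_labelling_of_family:
  assumes C: "C \<in> B \<rightarrow>\<^sub>E induced_subcomplexes X" and B: "finite B"
  shows "family_of_labelling X B (labelling_of_family X B C) = C"
proof (rule PiE_ext[OF family_of_labelling_in[OF labelling_of_family_in[OF B] B] C])
  fix i assume i: "i \<in> B"
  then obtain V where V: "V \<subseteq> vertices X" "C i = induced_subcomplex X V"
    using C by (auto simp: induced_subcomplexes_def PiE_iff)
  have "{v \<in> vertices X. Poly_Mapping.lookup (labelling_of_family X B C v) i = 0} = V"
    using i V
    by (auto simp: lookup_labelling_of_family[OF B] vertices_induced_subcomplex subset_eq split: if_splits)
  then show "family_of_labelling X B (labelling_of_family X B C) i = C i"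
    by (simp add: family_of_labelling_eq[OF labelling_of_family_in[OF B] B i] V(2))
qed

text \<open>
  The subcomplexes occurring in the criterion of Bayer and Sturmfels are the intersections of
  members of the family: a multidegree \<open>b\<close> gives the index set of the variables missing
  from \<open>b\<close>, and every \<open>B' \<subseteq> B\<close> arises in this way from the product of the
  variables in \<open>B - B'\<close>.
\<close>

lemma resolution_iff_acyclic_family:
  fixes B :: "'i set"
  assumes "polyhedral_complex X" and "incidence_signs X \<epsilon>"
    and a: "a \<in> squarefree_labellings X B" and B: "finite B"
  shows "gives_cellular_resolution TYPE('k::field) \<epsilon> X B a \<longleftrightarrow>
    family_of_labelling X B a \<in> acyclic_families TYPE('k) \<epsilon> X B"
proof -
  interpret labelled_complex X \<epsilon> B a
    using assms by unfold_locales (simp_all add: squarefree_labellings_def)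
  let ?P = "\<lambda>K. empty_complex K \<or> acyclic_over TYPE('k) \<epsilon> K"
  let ?I = "\<lambda>B'. X \<inter> (\<Inter>i\<in>B'. family_of_labelling X B a i)"
  have "(\<forall>b\<in>monomials_in B. ?P (sublevel_complex X a b)) \<longleftrightarrow> (\<forall>B'\<subseteq>B. ?P (?I B'))"
  proof (intro iffI allI impI ballI)
    fix B' assume P: "\<forall>b\<in>monomials_in B. ?P (sublevel_complex X a b)" and B': "B' \<subseteq> B"
    have keys: "Poly_Mapping.keys (all_ones (B - B')) = B - B'"
      using B by (simp add: keys_all_ones)
    then have "B - Poly_Mapping.keys (all_ones (B - B')) = B'"
      using B' by auto
    then have "sublevel_complex X a (all_ones (B - B')) = ?I B'"
      using sublevel_complex_eq_Inter[OF assms(1) a B, of "all_ones (B - B')"] by simp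
    moreover have "all_ones (B - B') \<in> monomials_in B"
      using keys by (auto simp: monomials_in_def)
    ultimately show "?P (?I B')"
      using P by metis
  next
    fix b :: "'i \<Rightarrow>\<^sub>0 nat" assume P: "\<forall>B'\<subseteq>B. ?P (?I B')"
    then have "?P (?I (B - Poly_Mapping.keys b))"
      by (metis Diff_subset)
    then show "?P (sublevel_complex X a b)"
      by (simp add: sublevel_complex_eq_Inter[OF assms(1) a B])
  qed
  then show ?thesis
    using family_of_labelling_in[OF a B]
    by (simp add: gives_cellular_resolution_iff acyclic_families_def)
qed

theorem theorem2p5:
  fixes X :: "'a::euclidean_space set set"
    and \<epsilon> :: "'a set \<Rightarrow> 'a set \<Rightarrow> int"
    and B :: "'i set"
  assumes "polyhedral_complex X"
    and "incidence_signs X \<epsilon>"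
    and "acyclic_over TYPE('k::field) \<epsilon> X"
    and "finite B"
  shows "bij_betw (family_of_labelling X B)
           (squarefree_resolution_labellings TYPE('k) \<epsilon> X B)
           (acyclic_families TYPE('k) \<epsilon> X B) \<and>
         bij_betw (labelling_of_family X B)
           (acyclic_families TYPE('k) \<epsilon> X B)
           (squarefree_resolution_labellings TYPE('k) \<epsilon> X B) \<and>
         (\<forall>a\<in>squarefree_resolution_labellings TYPE('k) \<epsilon> X B.
           labelling_of_family X B (family_of_labelling X B a) = a) \<and>
         (\<forall>C\<in>acyclic_families TYPE('k) \<epsilon> X B.
           family_of_labelling X B (labelling_of_family X B C) = C)"
proof -
  let ?L = "squarefree_resolution_labellings TYPE('k) \<epsilon> X B"
  let ?A = "acyclic_families TYPE('k) \<epsilon> X B"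
  let ?f = "family_of_labelling X B" and ?g = "labelling_of_family X B"
  note B = assms(4)
  note resolution_iff = resolution_iff_acyclic_family[OF assms(1,2) _ B, where 'k = 'k]
  \<comment> \<open>With this, both maps are restrictions of the mutually inverse bijections between squarefree
    labellings and families of induced subcomplexes.\<close>
  have L: "?L = {a \<in> squarefree_labellings X B. ?f a \<in> ?A}"
    using resolution_iff
    by (auto simp: squarefree_resolution_labellings_def squarefree_labellings_def)
  have gf: "\<forall>a\<in>?L. ?g (?f a) = a"
    using labelling_of_family_of_labelling[OF _ B] L by blast
  have fg: "\<forall>C\<in>?A. ?f (?g C) = C"
    using family_of_labelling_of_family[OF _ B] by (auto simp: acyclic_families_def)
  have f_in: "?f ` ?L \<subseteq> ?A"
    using L by blast
  have g_in: "?g ` ?A \<subseteq> ?L"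
    using L fg labelling_of_family_in[OF B] by auto
  show ?thesis
    using bij_betw_byWitness[OF gf fg f_in g_in] bij_betw_byWitness[OF fg gf g_in f_in] gf fg
    by blast
qed

end
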